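(* Let $\|\cdot\|$ be a norm on $\mathbb{R}^2$, let $n$ be odd, and let $v_1,\dots,v_n\in\mathbb{R}^2$ satisfy $\|v_i\|=1$ for all $i$. Let $P=\mathrm{conv}\{\pm v_1,\dots,\pm v_n\}$, and assume that the points $v_1,v_2,\dots,v_n,-v_1,-v_2,\dots,-v_n$ come in this (cyclic) order along the boundary of $P$. Then \[ \|v_1-v_2+v_3-v_4+\dots-v_{n-1}+v_n\|\le 1 . \]
   Context: $\mathrm{conv}$ denotes the convex hull. The signs in the sum alternate, starting and ending with $+$. *)

theory Defs
  imports "HOL-Analysis.Analysis"
begin

definition is_norm :: "('a::real_vector \<Rightarrow> real) \<Rightarrow> bool" where
  "is_norm N \<longleftrightarrow>
     (\<forall>x. 0 \<le> N x) \<and>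
     (\<forall>x. N x = 0 \<longleftrightarrow> x = 0) \<and>
     (\<forall>c x. N (c *\<^sub>R x) = \<bar>c\<bar> * N x) \<and>
     (\<forall>x y. N (x + y) \<le> N x + N y)"

text \<open>A closed path running once around the boundary of a convex polygon, in either direction and
  from any starting point. A polygon without interior points is a line segment; it is its own
  topological frontier, and running once around it means going from one end to the other and back.\<close>

definition boundary_circuit :: "(real^2) set \<Rightarrow> (real \<Rightarrow> real^2) \<Rightarrow> bool" where
  "boundary_circuit P g \<longleftrightarrow>
     (if interior P \<noteq> {}
      then simple_path g \<and> pathfinish g = pathstart g \<and> path_image g = frontier P
      else \<exists>a b s. P = closed_segment a b \<and> s \<in> {0..1} \<and>
             g = shiftpath s (linepath a b +++ linepath b a))"

text \<open>The points \<open>w 1, \<dots>, w m\<close> are met in this order during one circuit. Since the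
  starting point of the circuit is arbitrary, this is a property of the cyclic sequence. Consecutive
  points are allowed to coincide.\<close>

definition cyclic_order_along_boundary ::
    "(real^2) set \<Rightarrow> nat \<Rightarrow> (nat \<Rightarrow> real^2) \<Rightarrow> bool" where
  "cyclic_order_along_boundary P m w \<longleftrightarrow>
     (\<exists>g t. boundary_circuit P g \<and> mono_on {1..m} t \<and>
        (\<forall>i\<in>{1..m}. t i \<in> {0..1} \<and> g (t i) = w i))"

end

theory Submission
  imports Defs
begin

text \<open>
  By separation it suffices to show that the alternating sum lies in \<open>P\<close>, that is, that a linear
  functional takes on it at most the maximal value \<open>M\<close> that it takes on the points \<open>\<plusminus>v\<^sub>i\<close>. A line
  that meets the interior of \<open>P\<close> crosses the boundary only twice, so the functional decreases
  along the list \<open>\<plusminus>v\<^sub>1, \<dots>, \<plusminus>v\<^sub>n\<close> from a maximal point to its antipode. Since \<open>n\<close> is odd,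
  starting the alternating sum at the maximal point changes it at most by a sign, and an alternating
  sum with an odd number of decreasing terms lies between its last and its first term.
\<close>

section \<open>Level lines and boundary circuits\<close>

lemma three_level_crossings:
  fixes h :: "real \<Rightarrow> real"
  assumes "continuous_on {0..1} h" and "0 \<le> t1" "t1 \<le> t2" "t2 \<le> t3" "t3 \<le> t4" "t4 \<le> 1"
    and "c < h t1" "h t2 < c" "c < h t3" "h t4 < c"
  shows "\<exists>x y z. 0 < x \<and> x < y \<and> y < z \<and> z < 1 \<and> h x = c \<and> h y = c \<and> h z = c"
proof -
  have cont: "continuous_on {s..t} h" if "0 \<le> s" "t \<le> 1" for s t
    using assms(1) by (rule continuous_on_subset) (use that in auto)
  obtain x where x: "t1 \<le> x" "x \<le> t2" "h x = c"
    using IVT2'[of h t2 c t1] cont[of t1 t2] assms by force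
  obtain y where y: "t2 \<le> y" "y \<le> t3" "h y = c"
    using IVT'[of h t2 c t3] cont[of t2 t3] assms by force
  obtain z where z: "t3 \<le> z" "z \<le> t4" "h z = c"
    using IVT2'[of h t4 c t3] cont[of t3 t4] assms by force
  \<comment> \<open>No crossing falls on one of the four given times, so the three are distinct and
    avoid 0 and 1. For a closed path these two parameters give the same point and must be excluded
    later.\<close>
  have "x \<noteq> t1" "x \<noteq> t2" "y \<noteq> t2" "y \<noteq> t3" "z \<noteq> t3" "z \<noteq> t4"
    using x y z assms(7-10) by auto
  then have "0 < x" "x < y" "y < z" "z < 1"
    using x y z assms(2-6) by auto
  then show ?thesis using x y z by blast
qed

text \<open>A point strictly between an interior point and a point of the closure is interior. So if
  two frontier points lay at different distances on one ray from \<open>w\<close>, the nearer one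
  would be interior. The sign condition on \<open>k * l\<close> puts both on the same side of
  \<open>w\<close>.\<close>

lemma frontier_points_on_ray:
  fixes P :: "'a::euclidean_space set"
  assumes "convex P" "w \<in> interior P" "w + k *\<^sub>R d \<in> frontier P" "w + l *\<^sub>R d \<in> frontier P"
    and "0 < k * l"
  shows "k = l"
proof -
  have False if kl: "\<bar>k\<bar> < \<bar>l\<bar>" "0 < k * l"
    and fr: "w + k *\<^sub>R d \<in> frontier P" "w + l *\<^sub>R d \<in> frontier P" for k l
  proof -
    have "l \<noteq> 0" using kl by auto
    have "0 < k / l" using kl by (simp add: zero_less_mult_iff zero_less_divide_iff)
    moreover have "k / l < 1" using kl by (auto simp: divide_less_eq_1 zero_less_mult_iff)
    moreover have "w + l *\<^sub>R d \<in> closure P" using fr by (simp add: frontier_def)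
    \<comment> \<open>Shrinking the farther point towards \<open>w\<close> by the factor
      \<open>k / l\<close> yields the nearer one.\<close>
    ultimately have "(w + l *\<^sub>R d) - (1 - k / l) *\<^sub>R ((w + l *\<^sub>R d) - w) \<in> interior P"
      using mem_interior_closure_convex_shrink[OF assms(1,2), of "w + l *\<^sub>R d" "1 - k / l"] by simp
    moreover have "(w + l *\<^sub>R d) - (1 - k / l) *\<^sub>R ((w + l *\<^sub>R d) - w) = w + k *\<^sub>R d"
      using \<open>l \<noteq> 0\<close> by (simp add: algebra_simps)
    ultimately show False using fr(1) by (metis DiffD2 frontier_def)
  qed
  from this[of k l] this[of l k] assms have "\<bar>k\<bar> = \<bar>l\<bar>"
    by (metis linorder_neqE_linordered_idom mult.commute)
  then show ?thesis using assms(5) by (auto simp: abs_if zero_less_mult_iff split: if_splits)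
qed

lemma orthogonal_real2:
  fixes a u :: "real^2"
  assumes "a \<bullet> u = 0" "a \<noteq> 0"
  shows "\<exists>k. u = k *\<^sub>R vector [- a$2, a$1]"
proof (cases "a$1 = 0")
  case True
  then have "a$2 \<noteq> 0" "a$2 * u$2 = 0" using assms by (auto simp: inner_vec_def sum_2 vec_eq_iff forall_2)
  then show ?thesis using True
    by (intro exI[of _ "- u$1 / a$2"]) (auto simp: vec_eq_iff forall_2)
next
  case False
  have "a$1 * u$1 = - a$2 * u$2" using assms(1) by (simp add: inner_vec_def sum_2)
  then show ?thesis using False
    by (intro exI[of _ "u$2 / a$1"]) (auto simp: vec_eq_iff forall_2 field_simps)
qed

text \<open>\<open>p\<close> and \<open>q\<close> may be boundary points. An open half-plane or
  half-space that meets the closure of the interior meets the interior itself, so interior points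
  exist on both sides of the level and connectedness finishes.\<close>

lemma interior_meets_level:
  fixes P :: "'a::euclidean_space set"
  assumes "convex P" "interior P \<noteq> {}" "p \<in> P" "q \<in> P" "a \<bullet> p < c" "c < a \<bullet> q"
  shows "\<exists>w\<in>interior P. a \<bullet> w = c"
proof -
  have cl: "closure (interior P) = closure P"
    using assms by (simp add: convex_closure_interior)
  have "p \<in> closure (interior P)" "q \<in> closure (interior P)"
    using assms closure_subset unfolding cl by auto
  then have "{x. a \<bullet> x < c} \<inter> closure (interior P) \<noteq> {}" "{x. a \<bullet> x > c} \<inter> closure (interior P) \<noteq> {}"
    using assms by auto
  then have "{x. a \<bullet> x < c} \<inter> interior P \<noteq> {}" "{x. a \<bullet> x > c} \<inter> interior P \<noteq> {}"
    using open_Int_closure_eq_empty open_halfspace_lt open_halfspace_gt by metis+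
  then obtain p' q' where "p' \<in> interior P" "a \<bullet> p' < c" "q' \<in> interior P" "c < a \<bullet> q'"
    by blast
  moreover have "connected (interior P)"
    using assms by (simp add: convex_connected convex_interior)
  ultimately show ?thesis
    using connected_ivt_hyperplane[of "interior P" p' q' a c] by force
qed

text \<open>The level line passes through an interior point \<open>w\<close>. Each of the three
  frontier points has a nonzero offset from \<open>w\<close> along the line, and two of the offsets
  share a sign.\<close>

lemma at_most_two_frontier_points:
  fixes P :: "(real^2) set"
  assumes "convex P" "interior P \<noteq> {}" "p \<in> P" "q \<in> P" "a \<bullet> p < c" "c < a \<bullet> q"
    and fr: "x \<in> frontier P" "y \<in> frontier P" "z \<in> frontier P"
    and lev: "a \<bullet> x = c" "a \<bullet> y = c" "a \<bullet> z = c"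
  shows "x = y \<or> y = z \<or> x = z"
proof -
  obtain w where w: "w \<in> interior P" "a \<bullet> w = c"
    using interior_meets_level assms by metis
  define d :: "real^2" where "d = vector [- a$2, a$1]"
  have "a \<noteq> 0" using assms(5,6) by auto
  have on_line: "\<exists>k. u = w + k *\<^sub>R d \<and> k \<noteq> 0" if "u \<in> frontier P" "a \<bullet> u = c" for u
  proof -
    have "a \<bullet> (u - w) = 0" using that w by (simp add: inner_diff_right)
    then obtain k where "u - w = k *\<^sub>R d"
      using orthogonal_real2 \<open>a \<noteq> 0\<close> unfolding d_def by blast
    then have "u = w + k *\<^sub>R d" by (simp add: algebra_simps)
    moreover have "u \<noteq> w" using that w by (auto simp: frontier_def)
    ultimately show ?thesis by auto
  qed
  obtain i j k where
    eqs: "x = w + i *\<^sub>R d" "y = w + j *\<^sub>R d" "z = w + k *\<^sub>R d" and "i \<noteq> 0" "j \<noteq> 0" "k \<noteq> 0"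
    using on_line fr lev by metis
  then have "0 < i * j \<or> 0 < j * k \<or> 0 < i * k"
    by (auto simp: zero_less_mult_iff)
  then show ?thesis
    using frontier_points_on_ray[OF assms(1) w(1)] fr eqs by metis
qed

text \<open>In the nondegenerate case the circuit is injective on the open unit interval, so three
  parameters would give three frontier points on one line. A degenerate polygon is a segment run
  through once in each direction, and each run meets the level at most once.\<close>

lemma boundary_circuit_level:
  assumes "boundary_circuit P g" "convex P" "p \<in> P" "q \<in> P" "a \<bullet> p < c" "c < a \<bullet> q"
    and xyz: "0 < x" "x < y" "y < z" "z < 1"
    and lev: "a \<bullet> g x = c" "a \<bullet> g y = c" "a \<bullet> g z = c"
  shows False
proof (cases "interior P = {}")
  case False
  then have g: "simple_path g" "path_image g = frontier P"
    using assms(1) by (auto simp: boundary_circuit_def)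
  have "g u \<in> frontier P" if "0 < u" "u < 1" for u
    using g(2) that by (auto simp: path_image_def)
  then have "g x = g y \<or> g y = g z \<or> g x = g z"
    using at_most_two_frontier_points[OF assms(2) False assms(3-6)] lev xyz by auto
  moreover have "g s \<noteq> g t" if "0 < s" "s < t" "t < 1" for s t
    using g(1) that by (force simp: simple_path_def loop_free_def)
  ultimately show False using xyz by (metis order.strict_trans)
next
  case True
  then obtain d e s where P: "P = closed_segment d e" and s: "s \<in> {0..1}"
    and g: "g = shiftpath s (linepath d e +++ linepath e d)"
    using assms(1) by (auto simp: boundary_circuit_def)
  define A where "A = a \<bullet> d"
  define B where "B = a \<bullet> e"
  have "A \<noteq> B"
  proof
    assume "A = B"
    then have "a \<bullet> u = A" if "u \<in> P" for u
      using that unfolding P closed_segment_def A_def B_def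
      by (auto simp: inner_add_right simp flip: distrib_right)
    then show False using assms(3-6) by force
  qed
  \<comment> \<open>\<open>u t\<close> is the parameter on the unshifted path, that is,
    \<open>s + t\<close> reduced modulo 1; hence it is injective for \<open>t\<close> strictly
    between 0 and 1.\<close>
  define u where "u t = (if s + t \<le> 1 then s + t else s + t - 1)" for t
  have g_u: "a \<bullet> g t = (if u t \<le> 1/2 then A + 2 * u t * (B - A) else A + (2 - 2 * u t) * (B - A))" for t
    unfolding g u_def shiftpath_def joinpaths_def linepath_def A_def B_def
    by (auto simp: inner_add_right algebra_simps)
  \<comment> \<open>\<open>r\<close> is the fraction of the way from \<open>d\<close> to
    \<open>e\<close> at which the level is \<open>c\<close>: the outward run is there at
    \<open>2 * u t = r\<close>, the return run at \<open>2 - 2 * u t = r\<close>. Three distinct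
    values of \<open>u\<close> cannot share these two solutions.\<close>
  define r where "r = (c - A) / (B - A)"
  have u_cases: "2 * u t = r \<or> 2 * u t = 2 - r" if "a \<bullet> g t = c" for t
    using that \<open>A \<noteq> B\<close> unfolding g_u r_def by (auto split: if_splits)
  have u_inj: "u s' \<noteq> u t" if "0 < s'" "s' < t" "t < 1" for s' t
    using that by (auto simp: u_def)
  show False
    using u_cases[OF lev(1)] u_cases[OF lev(2)] u_cases[OF lev(3)]
      u_inj[of x y] u_inj[of y z] u_inj[of x z] xyz by auto
qed

lemma boundary_circuit_path:
  assumes "boundary_circuit P g"
  shows "path g"
proof (cases "interior P = {}")
  case True
  then obtain d e s where "s \<in> {0..1}" "g = shiftpath s (linepath d e +++ linepath e d)"
    using assms by (auto simp: boundary_circuit_def)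
  then show ?thesis by (auto intro!: path_shiftpath)
qed (use assms in \<open>auto simp: boundary_circuit_def simple_path_def\<close>)

text \<open>Four alternating values along the circuit force three crossings of the level
  \<open>c\<close>. The points \<open>w i\<close> and \<open>w j\<close> show that \<open>P\<close>
  has points on both sides of it.\<close>

lemma cyclic_order_no_alternation:
  assumes "cyclic_order_along_boundary P m w" "convex P" "\<And>i. i \<in> {1..m} \<Longrightarrow> w i \<in> P"
    and "1 \<le> i" "i \<le> j" "j \<le> k" "k \<le> l" "l \<le> m"
    and "c < a \<bullet> w i" "a \<bullet> w j < c" "c < a \<bullet> w k" "a \<bullet> w l < c"
  shows False
proof -
  obtain g t where g: "boundary_circuit P g" and t: "mono_on {1..m} t"
    and gt: "\<And>i. i \<in> {1..m} \<Longrightarrow> t i \<in> {0..1} \<and> g (t i) = w i"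
    using assms(1) unfolding cyclic_order_along_boundary_def by blast
  have "continuous_on {0..1} (\<lambda>s. a \<bullet> g s)"
    using boundary_circuit_path[OF g] unfolding path_def by (intro continuous_intros)
  moreover have "t i \<le> t j" "t j \<le> t k" "t k \<le> t l"
    using assms(4-8) by (auto intro!: mono_onD[OF t])
  moreover have "0 \<le> t i" "t l \<le> 1" "g (t i) = w i" "g (t j) = w j" "g (t k) = w k" "g (t l) = w l"
    using gt[of i] gt[of j] gt[of k] gt[of l] assms(4-8) by auto
  ultimately obtain x y z where "0 < x" "x < y" "y < z" "z < 1"
    "a \<bullet> g x = c" "a \<bullet> g y = c" "a \<bullet> g z = c"
    using three_level_crossings[of "\<lambda>s. a \<bullet> g s" "t i" "t j" "t k" "t l" c] assms(9-12) by auto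
  moreover have "w i \<in> P" "w j \<in> P" using assms(3-8) by auto
  ultimately show False
    using boundary_circuit_level[OF g assms(2), of "w j" "w i"] assms(9,10) by blast
qed

section \<open>Alternating sums of antiperiodic sequences\<close>

lemma alternating_sum_decreasing:
  fixes f :: "nat \<Rightarrow> real"
  assumes "\<And>i. i < 2 * m \<Longrightarrow> f (Suc i) \<le> f i"
  shows "f (2 * m) \<le> (\<Sum>i<Suc (2 * m). (-1) ^ i * f i) \<and> (\<Sum>i<Suc (2 * m). (-1) ^ i * f i) \<le> f 0"
  using assms
proof (induction m)
  case (Suc m)
  \<comment> \<open>The two new terms contribute \<open>f (2 * m + 2) - f (2 * m + 1)\<close>. This
    is at most 0, which keeps the upper bound; added to \<open>f (2 * m)\<close> it is at least
    \<open>f (2 * m + 2)\<close>, which gives the lower one.\<close>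
  have "f (Suc (2 * m)) \<le> f (2 * m)" "f (Suc (Suc (2 * m))) \<le> f (Suc (2 * m))"
    using Suc.prems by auto
  moreover have "f (2 * m) \<le> (\<Sum>i<Suc (2 * m). (-1) ^ i * f i) \<and>
      (\<Sum>i<Suc (2 * m). (-1) ^ i * f i) \<le> f 0"
    using Suc by auto
  ultimately show ?case by simp
qed auto

text \<open>Moving the window one step trades \<open>f (k + 1)\<close> for
  \<open>f (k + 1 + n)\<close>. Periodicity on \<open>{1..n}\<close> suffices because the window
  starts no later than \<open>n + 1\<close>.\<close>

lemma sum_shift_window:
  fixes f :: "nat \<Rightarrow> real"
  assumes "\<And>i. i \<in> {1..n} \<Longrightarrow> f (i + n) = f i" "k \<le> n"
  shows "(\<Sum>i<n. f (k + 1 + i)) = (\<Sum>i=1..n. f i)"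
  using assms(2)
proof (induction k)
  case 0
  have "(\<Sum>i=1..n. f i) = (\<Sum>i<n. f (Suc i))"
    by (rule sum.reindex_bij_witness[of _ Suc "\<lambda>i. i - 1"]) auto
  then show ?case by simp
next
  case (Suc k)
  have "(\<Sum>i<n. f (k + 1 + i)) + f (k + 1 + n) = f (k + 1) + (\<Sum>i<n. f (Suc k + 1 + i))"
    using sum.lessThan_Suc[of "\<lambda>i. f (k + 1 + i)" n] sum.lessThan_Suc_shift[of "\<lambda>i. f (k + 1 + i)" n]
    by simp
  then show ?case using Suc assms(1)[of "k + 1"] by simp
qed

text \<open>On the window from \<open>k\<close> to \<open>k + n\<close> the sequence runs from its
  maximum \<open>f k\<close> to its minimum \<open>- f k\<close>. A rise inside the window would
  complete a high-low-high-low pattern, so it is decreasing there. As \<open>k \<le> n\<close>, the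
  window stays within \<open>{1..2 * n}\<close>.\<close>

lemma antiperiodic_alternating_sum_bound:
  fixes f :: "nat \<Rightarrow> real"
  assumes "odd n" "\<And>i. i \<in> {1..n} \<Longrightarrow> f (i + n) = - f i"
    and k: "k \<in> {1..n}" "\<And>i. i \<in> {1..n} \<Longrightarrow> \<bar>f i\<bar> \<le> f k"
    and no_alt: "\<And>i j k l c. 1 \<le> i \<Longrightarrow> i \<le> j \<Longrightarrow> j \<le> k \<Longrightarrow> k \<le> l \<Longrightarrow> l \<le> 2 * n \<Longrightarrow>
      c < f i \<Longrightarrow> f j < c \<Longrightarrow> c < f k \<Longrightarrow> f l < c \<Longrightarrow> False"
  shows "\<bar>\<Sum>i=1..n. (-1) ^ (i + 1) * f i\<bar> \<le> f k"
proof -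
  have bound: "\<bar>f i\<bar> \<le> f k" if "i \<in> {1..2*n}" for i
  proof (cases "i \<le> n")
    case False
    then have "i - n \<in> {1..n}" using that by auto
    then show ?thesis using k(2)[of "i - n"] assms(2)[of "i - n"] False by simp
  qed (use k(2) that in auto)
  have dec: "f j \<le> f i" if ij: "k \<le> i" "i \<le> j" "j \<le> k + n" for i j
  proof (rule ccontr)
    assume "\<not> f j \<le> f i"
    then obtain c where c: "f i < c" "c < f j" using dense[of "f i" "f j"] by auto
    have "f j \<le> f k" "- f k \<le> f i" using bound[of i] bound[of j] ij k(1) by auto
    moreover have "f (k + n) = - f k" using assms(2) k(1) by auto
    ultimately show False
      using no_alt[of k i j "k + n" c] c ij k(1) by auto
  qed
  obtain m where n: "n = Suc (2 * m)" using \<open>odd n\<close> by (auto elim: oddE)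
  define S where "S = (\<Sum>i<n. (-1) ^ i * f (k + i))"
  \<comment> \<open>For odd \<open>n\<close> a shift by \<open>n\<close> flips both the sign factor
    and \<open>f\<close>, so the signed terms are \<open>n\<close>-periodic and the sum may start at
    \<open>k\<close>.\<close>
  have "(\<Sum>i=1..n. (-1) ^ (i + 1) * f i) = (\<Sum>i<n. (-1) ^ (k - 1 + 1 + i + 1) * f (k - 1 + 1 + i))"
    by (rule sum_shift_window[of n "\<lambda>i. (-1) ^ (i + 1) * f i", symmetric])
      (use assms(1,2) k in \<open>auto simp: power_add\<close>)
  also have "\<dots> = (-1) ^ (k + 1) * S"
    unfolding S_def sum_distrib_left by (rule sum.cong) (use k(1) in \<open>auto simp: power_add\<close>)
  finally have "\<bar>\<Sum>i=1..n. (-1) ^ (i + 1) * f i\<bar> = \<bar>S\<bar>" by (simp add: abs_mult power_abs)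
  moreover have "f (k + 2 * m) \<le> S \<and> S \<le> f k"
    using alternating_sum_decreasing[of m "\<lambda>i. f (k + i)"] dec n unfolding S_def by simp
  moreover have "- f k \<le> f (k + 2 * m)"
    using bound[of "k + 2 * m"] k(1) n by auto
  ultimately show ?thesis by auto
qed

text \<open>Take \<open>k\<close> with \<open>\<bar>f k\<bar>\<close> largest. If \<open>f k\<close>
  is negative, the previous bound is applied to \<open>- f\<close>, which exchanges the two
  alternation patterns; hence both are excluded.\<close>

lemma antiperiodic_alternating_sum_le_max:
  fixes f :: "nat \<Rightarrow> real"
  assumes "odd n" "\<And>i. i \<in> {1..n} \<Longrightarrow> f (i + n) = - f i"
    and no_alt: "\<And>i j k l c. 1 \<le> i \<Longrightarrow> i \<le> j \<Longrightarrow> j \<le> k \<Longrightarrow> k \<le> l \<Longrightarrow> l \<le> 2 * n \<Longrightarrow>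
      c < f i \<Longrightarrow> f j < c \<Longrightarrow> c < f k \<Longrightarrow> f l < c \<Longrightarrow> False"
    and no_alt': "\<And>i j k l c. 1 \<le> i \<Longrightarrow> i \<le> j \<Longrightarrow> j \<le> k \<Longrightarrow> k \<le> l \<Longrightarrow> l \<le> 2 * n \<Longrightarrow>
      f i < c \<Longrightarrow> c < f j \<Longrightarrow> f k < c \<Longrightarrow> c < f l \<Longrightarrow> False"
  shows "\<exists>k\<in>{1..n}. \<bar>\<Sum>i=1..n. (-1) ^ (i + 1) * f i\<bar> \<le> \<bar>f k\<bar>"
proof -
  have "{1..n} \<noteq> {}" using \<open>odd n\<close> by (cases n) auto
  then have "Max ((\<lambda>i. \<bar>f i\<bar>) ` {1..n}) \<in> (\<lambda>i. \<bar>f i\<bar>) ` {1..n}"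
    by (intro Max_in) auto
  then obtain k where k: "k \<in> {1..n}" "Max ((\<lambda>i. \<bar>f i\<bar>) ` {1..n}) = \<bar>f k\<bar>" by auto
  then have max: "\<bar>f i\<bar> \<le> \<bar>f k\<bar>" if "i \<in> {1..n}" for i
    using that by (metis Max_ge finite_atLeastAtMost finite_imageI imageI)
  show ?thesis
  proof (cases "0 \<le> f k")
    case True
    have "\<bar>\<Sum>i=1..n. (-1) ^ (i + 1) * f i\<bar> \<le> f k"
    proof (rule antiperiodic_alternating_sum_bound[OF assms(1) _ k(1)])
      fix i j k l c
      assume "1 \<le> i" "i \<le> j" "j \<le> k" "k \<le> l" "l \<le> 2 * n"
        "c < f i" "f j < c" "c < f k" "f l < c"
      then show False by (rule no_alt)
    qed (use assms(2) max True in auto)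
    then show ?thesis using k(1) by force
  next
    case False
    have "\<bar>\<Sum>i=1..n. (-1) ^ (i + 1) * (- f i)\<bar> \<le> - f k"
    proof (rule antiperiodic_alternating_sum_bound[OF assms(1) _ k(1)])
      fix i j k l c
      assume "1 \<le> i" "i \<le> j" "j \<le> k" "k \<le> l" "l \<le> 2 * n"
        "c < - f i" "- f j < c" "c < - f k" "- f l < c"
      then show False using no_alt'[of i j k l "- c"] by auto
    qed (use assms(2) max False in auto)
    then show ?thesis using k(1) False by (intro bexI[of _ k]) (auto simp: sum_negf)
  qed
qed

section \<open>The unit ball and the separation argument\<close>

lemma is_norm_convex_ball:
  assumes "is_norm N"
  shows "convex {x. N x \<le> 1}"
proof (rule convexI, clarify)
  fix x y and u v :: real
  assume *: "N x \<le> 1" "N y \<le> 1" "0 \<le> u" "0 \<le> v" "u + v = 1"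
  have "N (u *\<^sub>R x + v *\<^sub>R y) \<le> u * N x + v * N y"
    using assms * unfolding is_norm_def by (metis abs_of_nonneg)
  also have "\<dots> \<le> u * 1 + v * 1"
    using * by (intro add_mono mult_left_mono)
  finally show "N (u *\<^sub>R x + v *\<^sub>R y) \<le> 1" using * by simp
qed

theorem theorem2:
  fixes N :: "real^2 \<Rightarrow> real" and n :: nat and v :: "nat \<Rightarrow> real^2" and P :: "(real^2) set"
  assumes "is_norm N"
    and "odd n"
    and "\<And>i. i \<in> {1..n} \<Longrightarrow> N (v i) = 1"
    and "P = convex hull (v ` {1..n} \<union> (\<lambda>i. - v i) ` {1..n})"
    and "cyclic_order_along_boundary P (2 * n) (\<lambda>i. if i \<le> n then v i else - v (i - n))"
  shows "N (\<Sum>i=1..n. (-1) ^ (i + 1) *\<^sub>R v i) \<le> 1"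
proof -
  define w where "w i = (if i \<le> n then v i else - v (i - n))" for i
  define s where "s = (\<Sum>i=1..n. (-1) ^ (i + 1) *\<^sub>R v i)"
  have cyc: "cyclic_order_along_boundary P (2 * n) w"
    using assms(5) unfolding w_def .
  have "convex P" "closed P"
    unfolding assms(4) by (auto intro!: compact_imp_closed finite_imp_compact_convex_hull)
  have vP: "v i \<in> P" "- v i \<in> P" if "i \<in> {1..n}" for i
    unfolding assms(4) using that by (auto intro!: hull_inc)
  have wP: "w i \<in> P" if "i \<in> {1..2*n}" for i
  proof (cases "i \<le> n")
    case False
    then have "i - n \<in> {1..n}" using that by auto
    then show ?thesis using vP False by (simp add: w_def)
  qed (use that vP in \<open>auto simp: w_def\<close>)
  have "s \<in> P"
  proof (rule ccontr)
    assume "s \<notin> P"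
    then obtain a b where ab: "a \<bullet> s < b" "\<And>x. x \<in> P \<Longrightarrow> b < a \<bullet> x"
      using separating_hyperplane_closed_point[OF \<open>convex P\<close> \<open>closed P\<close>] by blast
    have "\<exists>k\<in>{1..n}. \<bar>\<Sum>i=1..n. (-1) ^ (i + 1) * (a \<bullet> w i)\<bar> \<le> \<bar>a \<bullet> w k\<bar>"
    proof (rule antiperiodic_alternating_sum_le_max[OF assms(2)])
      fix i assume "i \<in> {1..n}"
      then show "a \<bullet> w (i + n) = - (a \<bullet> w i)" by (auto simp: w_def)
    next
      fix i j k l c
      assume "1 \<le> i" "i \<le> j" "j \<le> k" "k \<le> l" "l \<le> 2 * n"
        "c < a \<bullet> w i" "a \<bullet> w j < c" "c < a \<bullet> w k" "a \<bullet> w l < c"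
      then show False
        using cyclic_order_no_alternation[OF cyc \<open>convex P\<close> wP] by blast
    next
      fix i j k l c
      assume "1 \<le> i" "i \<le> j" "j \<le> k" "k \<le> l" "l \<le> 2 * n"
        "a \<bullet> w i < c" "c < a \<bullet> w j" "a \<bullet> w k < c" "c < a \<bullet> w l"
      then show False
        \<comment> \<open>Negating the functional and the level turns low-high-low-high into the
          excluded pattern.\<close>
        using cyclic_order_no_alternation[OF cyc \<open>convex P\<close> wP, of i j k l "- c" "- a"] by auto
    qed
    then obtain k where k: "k \<in> {1..n}"
      and "\<bar>\<Sum>i=1..n. (-1) ^ (i + 1) * (a \<bullet> w i)\<bar> \<le> \<bar>a \<bullet> w k\<bar>" by blast
    moreover have "a \<bullet> s = (\<Sum>i=1..n. (-1) ^ (i + 1) * (a \<bullet> w i))"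
      unfolding s_def inner_sum_right by (rule sum.cong) (auto simp: w_def)
    ultimately have "\<bar>a \<bullet> s\<bar> \<le> \<bar>a \<bullet> v k\<bar>" by (simp add: w_def)
    \<comment> \<open>Both \<open>v k\<close> and \<open>- v k\<close> lie in \<open>P\<close>, so
      separation puts \<open>a \<bullet> s\<close> strictly below
      \<open>- \<bar>a \<bullet> v k\<bar>\<close>.\<close>
    then show False using ab(1) ab(2)[OF vP(1)[OF k]] ab(2)[OF vP(2)[OF k]] by auto
  qed
  moreover have "N (- x) = N x" for x
  proof -
    have "N ((-1) *\<^sub>R x) = \<bar>-1\<bar> * N x"
      using assms(1) unfolding is_norm_def by blast
    then show ?thesis by simp
  qed
  then have "P \<subseteq> {x. N x \<le> 1}"
    unfolding assms(4) using assms(3) by (intro hull_minimal is_norm_convex_ball assms(1)) auto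
  ultimately show ?thesis unfolding s_def by auto
qed

end
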